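(* Let $p>q>0$ be coprime integers, and consider cut loci in $L_{p,q}$ with respect to the standard metric. If the cut locus $C(x)$ of a point $x\in L_{p,q}\setminus(S^1_w\cup S^1_z)$ is a simple spine of $L_{p,q}$, then its combinatorial type is independent of the choice of $x$ in $L_{p,q}\setminus(S^1_w\cup S^1_z)$; that is, for every $x'\in L_{p,q}\setminus(S^1_w\cup S^1_z)$ the cut locus $C(x')$ has the same combinatorial type as $C(x)$.
   Context: **Lens manifolds.** $L_{p,q}$ is the quotient of the unit sphere $S^3\subset\mathbb C^2$ by the action of the cyclic group $\mathbb Z_p$ whose generator is $(z,w)\mapsto(\xi z,\xi^q w)$, $\xi=e^{2\pi i/p}$. The standard metric is the constant curvature $+1$ metric induced from the round metric on $S^3$. The core circles $S^1_z,S^1_w\subset L_{p,q}$ are the images of the circles $\{(e^{i\phi},0)\}$ and $\{(0,e^{i\phi})\}$ in $S^3$, respectively. **Cut locus.** For a point $x$ of a complete Riemannian manifold $M$, the cut locus $C(x)$ is the closure of the set of points $y\in M$ such that the shortest geodesic between $x$ and $y$ is not unique. In $L_{p,q}$ the cut locus of $x$ is the image, under the covering $S^3\to L_{p,q}$, of the Voronoi diagram in $S^3$ of the set of preimages of $x$ (the set of points of $S^3$ whose nearest preimage is not unique), with the cell structure coming from this Voronoi diagram; its combinatorial type is that of this cell structure. **Polyhedra and spines.** Let $K$ be the 1-skeleton of a tetrahedron (the complete graph on 4 vertices). A compact 2-dimensional polyhedron is simple if the link of each of its points is homeomorphic to a circle, or a circle with a diameter, or $K$. A polyhedron $P\subset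 M$ is a spine of a closed 3-manifold $M$ if $M\setminus P$ is homeomorphic to an open 3-cell; a spine is simple if it is a simple polyhedron. *)

theory Defs
  imports "HOL-Analysis.Analysis"
begin

section \<open>Lens manifolds\<close>

abbreviation S3 :: "(complex \<times> complex) set" where
  "S3 \<equiv> sphere 0 1"

definition lens_gen :: "nat \<Rightarrow> nat \<Rightarrow> complex \<times> complex \<Rightarrow> complex \<times> complex" where
  "lens_gen p q = (\<lambda>(z, w). (cis (2 * pi / real p) * z, cis (2 * pi / real p) ^ q * w))"

text \<open>The points of the lens manifold are the orbits themselves, so a point of the quotient
  is also the set of its preimages in \<open>S3\<close>.\<close>

definition lens_proj :: "nat \<Rightarrow> nat \<Rightarrow> complex \<times> complex \<Rightarrow> (complex \<times> complex) set" where
  "lens_proj p q v = range (\<lambda>k::nat. (lens_gen p q ^^ k) v)"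

definition lens_space :: "nat \<Rightarrow> nat \<Rightarrow> (complex \<times> complex) set set" where
  "lens_space p q = lens_proj p q ` S3"

definition lens_topology :: "nat \<Rightarrow> nat \<Rightarrow> (complex \<times> complex) set topology" where
  "lens_topology p q = topology (\<lambda>U. U \<subseteq> lens_space p q \<and>
     openin (top_of_set S3) {v \<in> S3. lens_proj p q v \<in> U})"

lemma openin_lens_topology:
  "openin (lens_topology p q) U \<longleftrightarrow>
     U \<subseteq> lens_space p q \<and> openin (top_of_set S3) {v \<in> S3. lens_proj p q v \<in> U}"
proof -
  have "istopology (\<lambda>U. U \<subseteq> lens_space p q \<and>
          openin (top_of_set S3) {v \<in> S3. lens_proj p q v \<in> U})"
    unfolding istopology_def
  proof (intro conjI allI impI)
    fix S T
    assume S: "S \<subseteq> lens_space p q \<and> openin (top_of_set S3) {v \<in> S3. lens_proj p q v \<in> S}"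
      and T: "T \<subseteq> lens_space p q \<and> openin (top_of_set S3) {v \<in> S3. lens_proj p q v \<in> T}"
    have eq: "{v \<in> S3. lens_proj p q v \<in> S \<inter> T} =
        {v \<in> S3. lens_proj p q v \<in> S} \<inter> {v \<in> S3. lens_proj p q v \<in> T}"
      by blast
    show "S \<inter> T \<subseteq> lens_space p q" using S by blast
    show "openin (top_of_set S3) {v \<in> S3. lens_proj p q v \<in> S \<inter> T}"
      unfolding eq using S T by (intro openin_Int) simp_all
  next
    fix \<K>
    assume K: "\<forall>K\<in>\<K>. K \<subseteq> lens_space p q \<and>
      openin (top_of_set S3) {v \<in> S3. lens_proj p q v \<in> K}"
    have eq: "{v \<in> S3. lens_proj p q v \<in> \<Union>\<K>} = (\<Union>K\<in>\<K>. {v \<in> S3. lens_proj p q v \<in> K})"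
      by blast
    show "\<Union>\<K> \<subseteq> lens_space p q" using K by blast
    show "openin (top_of_set S3) {v \<in> S3. lens_proj p q v \<in> \<Union>\<K>}"
      unfolding eq using K by (intro openin_Union) blast
  qed
  then show ?thesis
    by (simp add: lens_topology_def topology_inverse')
qed

lemma topspace_lens_topology [simp]: "topspace (lens_topology p q) = lens_space p q"
proof
  show "topspace (lens_topology p q) \<subseteq> lens_space p q"
    using openin_topspace openin_lens_topology by blast
  have "{v \<in> S3. lens_proj p q v \<in> lens_space p q} = S3"
    by (auto simp: lens_space_def)
  then have "openin (lens_topology p q) (lens_space p q)"
    by (simp add: openin_lens_topology)
  then show "lens_space p q \<subseteq> topspace (lens_topology p q)"
    by (rule openin_subset)
qed

lemma quotient_map_lens_proj:
  "quotient_map (top_of_set S3) (lens_topology p q) (lens_proj p q)"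
  by (simp add: quotient_map_def openin_lens_topology lens_space_def)

definition core_z :: "nat \<Rightarrow> nat \<Rightarrow> (complex \<times> complex) set set" where
  "core_z p q = range (\<lambda>\<phi>. lens_proj p q (cis \<phi>, 0))"

definition core_w :: "nat \<Rightarrow> nat \<Rightarrow> (complex \<times> complex) set set" where
  "core_w p q = range (\<lambda>\<phi>. lens_proj p q (0, cis \<phi>))"


section \<open>The standard metric and cut loci\<close>

text \<open>The Riemannian distance of the round metric of curvature \<open>1\<close> on \<open>S3\<close>, and the one
  induced on the quotient by isometries.\<close>

definition sphere_dist :: "complex \<times> complex \<Rightarrow> complex \<times> complex \<Rightarrow> real" where
  "sphere_dist u v = arccos (u \<bullet> v)"

definition lens_dist :: "(complex \<times> complex) set \<Rightarrow> (complex \<times> complex) set \<Rightarrow> real" where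
  "lens_dist X Y = (INF (u, v) \<in> X \<times> Y. sphere_dist u v)"

text \<open>In a complete Riemannian manifold, the shortest geodesics from \<open>X\<close> to \<open>Y\<close>, parametrized
  by arc length, are the distance preserving maps of an interval of length \<open>d(X, Y)\<close>
  that join \<open>X\<close> to \<open>Y\<close>. Only the values of \<open>\<gamma>\<close> on that interval matter.\<close>

definition shortest_geodesic ::
  "nat \<Rightarrow> nat \<Rightarrow> (complex \<times> complex) set \<Rightarrow> (complex \<times> complex) set \<Rightarrow>
   (real \<Rightarrow> (complex \<times> complex) set) \<Rightarrow> bool" where
  "shortest_geodesic p q X Y \<gamma> \<longleftrightarrow>
     \<gamma> ` {0..lens_dist X Y} \<subseteq> lens_space p q \<and>
     \<gamma> 0 = X \<and> \<gamma> (lens_dist X Y) = Y \<and>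
     (\<forall>s\<in>{0..lens_dist X Y}. \<forall>t\<in>{0..lens_dist X Y}. lens_dist (\<gamma> s) (\<gamma> t) = \<bar>s - t\<bar>)"

definition cut_locus ::
  "nat \<Rightarrow> nat \<Rightarrow> (complex \<times> complex) set \<Rightarrow> (complex \<times> complex) set set" where
  "cut_locus p q X = lens_topology p q closure_of
     {Y \<in> lens_space p q. \<exists>\<gamma> \<gamma>'. shortest_geodesic p q X Y \<gamma> \<and> shortest_geodesic p q X Y \<gamma>' \<and>
        (\<exists>t\<in>{0..lens_dist X Y}. \<gamma> t \<noteq> \<gamma>' t)}"


section \<open>Voronoi cell structure and combinatorial type\<close>

definition nearest_sites ::
  "(complex \<times> complex) set \<Rightarrow> complex \<times> complex \<Rightarrow> (complex \<times> complex) set" where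
  "nearest_sites X v = {u \<in> X. \<forall>u'\<in>X. sphere_dist u v \<le> sphere_dist u' v}"

text \<open>The open cells of the Voronoi diagram of \<open>X\<close> are the nonempty sets of points of \<open>S3\<close> with a
  prescribed set \<open>T\<close> of nearest sites, \<open>T\<close> having at least two elements. Each is the intersection
  of \<open>S3\<close> with a relatively open convex cone. If that cone is a linear subspace (which
  for the orbits considered here requires \<open>T = X\<close> and \<open>q = 1\<close> or \<open>q = p - 1\<close>), the stratum is a
  great sphere instead of an open cell.\<close>

definition voronoi_cells ::
  "(complex \<times> complex) set \<Rightarrow> (complex \<times> complex) set set" where
  "voronoi_cells X =
     {{v \<in> S3. nearest_sites X v = T} | T. T \<subseteq> X \<and> 2 \<le> card T} - {{}}"

definition cut_locus_cells ::
  "nat \<Rightarrow> nat \<Rightarrow> (complex \<times> complex) set \<Rightarrow> (complex \<times> complex) set set set" where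
  "cut_locus_cells p q X = (\<lambda>F. lens_proj p q ` F) ` voronoi_cells X"

text \<open>Two spaces decomposed into open cells have the same combinatorial type if there is a
  homeomorphism between them taking open cells onto open cells. (For cell structures that are not
  regular, as those here, the poset of cells does not determine the way they are attached.)\<close>

definition same_combinatorial_type ::
  "'a topology \<Rightarrow> 'a set set \<Rightarrow> 'b topology \<Rightarrow> 'b set set \<Rightarrow> bool" where
  "same_combinatorial_type X \<A> Y \<B> \<longleftrightarrow>
     (\<exists>h. homeomorphic_map X Y h \<and> (\<lambda>A. h ` A) ` \<A> = \<B>)"


section \<open>Simple polyhedra and spines\<close>

text \<open>Every finite simplicial complex of dimension at most \<open>3\<close> embeds linearly in seven-dimensional
  space, so this ambient space suffices for polyhedra contained in 3-manifolds.\<close>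

definition triangulates :: "(real^7) set set \<Rightarrow> 'a topology \<Rightarrow> bool" where
  "triangulates C X \<longleftrightarrow> simplicial_complex C \<and> X homeomorphic_space top_of_set (\<Union>C)"

definition compact_polyhedron :: "'a topology \<Rightarrow> bool" where
  "compact_polyhedron X \<longleftrightarrow> (\<exists>C. triangulates C X)"

text \<open>The link of any point of the underlying space, not necessarily a vertex: the union of the
  simplices of its closed star that do not contain it.\<close>

definition link_of :: "'a::euclidean_space set set \<Rightarrow> 'a \<Rightarrow> 'a set" where
  "link_of C v = \<Union>{F \<in> C. v \<notin> F \<and> (\<exists>S\<in>C. v \<in> S \<and> F face_of S)}"

definition circle_with_diameter :: "complex set" where
  "circle_with_diameter = sphere 0 1 \<union> closed_segment (-1) 1"

definition tetrahedron_skeleton :: "(real^3) set" where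
  "tetrahedron_skeleton = \<Union>{e. e edge_of (convex hull (insert 0 Basis))}"

definition simple_polyhedron :: "'a topology \<Rightarrow> bool" where
  "simple_polyhedron X \<longleftrightarrow>
     (\<exists>C. triangulates C X \<and>
        (\<exists>S\<in>C. aff_dim S = 2) \<and> (\<forall>S\<in>C. aff_dim S \<le> 2) \<and>
        (\<forall>v\<in>\<Union>C. link_of C v homeomorphic sphere (0::complex) 1 \<or>
                  link_of C v homeomorphic circle_with_diameter \<or>
                  link_of C v homeomorphic tetrahedron_skeleton))"

definition spine :: "'a topology \<Rightarrow> 'a set \<Rightarrow> bool" where
  "spine M P \<longleftrightarrow> P \<subseteq> topspace M \<and> compact_polyhedron (subtopology M P) \<and>
     subtopology M (topspace M - P) homeomorphic_space top_of_set (ball (0::real^3) 1)"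

definition simple_spine :: "'a topology \<Rightarrow> 'a set \<Rightarrow> bool" where
  "simple_spine M P \<longleftrightarrow> spine M P \<and> simple_polyhedron (subtopology M P)"

end

theory Submission
  imports Defs
begin

text \<open>Write \<open>x = [a, b]\<close> and \<open>x' = [a', b']\<close> with nonzero coordinates. The diagonal linear maps
  \<open>S (z, w) = (a' z / a, b' w / b)\<close> and \<open>L = (S\<^sup>*)\<^sup>-\<^sup>1\<close> commute with the action, \<open>S\<close> carries
  the preimages of \<open>x\<close> to those of \<open>x'\<close>, and \<open>\<langle>S u, L v\<rangle> = \<langle>u, v\<rangle>\<close>. As the nearest sites of \<open>v\<close>
  are those that maximize \<open>\<langle>u, v\<rangle>\<close>, the map \<open>v \<mapsto> L v / \<bar>L v\<bar>\<close> of \<open>S\<^sup>3\<close> carries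
  Voronoi cells to Voronoi cells and descends to a homeomorphism of the lens space. It respects cut
  loci because a point of the lens space is joined to \<open>x\<close> by a unique shortest geodesic if and only
  if its lifts have a unique nearest site.\<close>

section \<open>Spherical geometry\<close>

text \<open>Removing from \<open>u\<close> and \<open>v\<close> their components along
  \<open>z\<close> leaves vectors of norm \<open>sin s\<close> and \<open>sin t\<close>.
  Cauchy-Schwarz for these remainders gives \<open>cos (s + t) \<le> u \<bullet> v\<close>. If
  \<open>s + t\<close> exceeds \<open>pi\<close>, the range of \<open>arccos\<close>
  suffices.\<close>

lemma arccos_inner_triangle:
  fixes u v z :: "'a::real_inner"
  assumes u: "norm u = 1" and v: "norm v = 1" and z: "norm z = 1"
  shows "arccos (u \<bullet> v) \<le> arccos (u \<bullet> z) + arccos (z \<bullet> v)"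
proof -
  have b: "\<bar>u \<bullet> v\<bar> \<le> 1" "\<bar>u \<bullet> z\<bar> \<le> 1" "\<bar>z \<bullet> v\<bar> \<le> 1"
    using Cauchy_Schwarz_ineq2[of u v] Cauchy_Schwarz_ineq2[of u z] Cauchy_Schwarz_ineq2[of z v] assms
    by auto
  define s where "s = arccos (u \<bullet> z)"
  define t where "t = arccos (z \<bullet> v)"
  have st: "0 \<le> s" "s \<le> pi" "0 \<le> t" "t \<le> pi"
    using b by (auto simp: s_def t_def intro!: arccos_lbound arccos_ubound)
  have cs: "cos s = u \<bullet> z" "cos t = z \<bullet> v"
    using b by (auto simp: s_def t_def cos_arccos_abs)
  show ?thesis
  proof (cases "s + t \<le> pi")
    case False
    then show ?thesis using arccos_ubound[of "u \<bullet> v"] b by (auto simp: s_def t_def abs_le_iff)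
  next
    case True
    define u' where "u' = u - (u \<bullet> z) *\<^sub>R z"
    define v' where "v' = v - (z \<bullet> v) *\<^sub>R z"
    have zz: "z \<bullet> z = 1" "u \<bullet> u = 1" "v \<bullet> v = 1" using assms by (auto simp: dot_square_norm)
    have uu: "u' \<bullet> u' = (sin s)\<^sup>2"
      unfolding sin_squared_eq cs by (simp add: u'_def inner_diff inner_commute zz power2_eq_square)
    have vv: "v' \<bullet> v' = (sin t)\<^sup>2"
      unfolding sin_squared_eq cs by (simp add: v'_def inner_diff inner_commute zz power2_eq_square)
    have uv: "u' \<bullet> v' = u \<bullet> v - cos s * cos t"
      by (simp add: u'_def v'_def inner_diff inner_commute zz cs algebra_simps)
    have "norm u' = sin s" "norm v' = sin t"
      using uu vv st sin_ge_zero by (auto simp: norm_eq_sqrt_inner)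
    then have "\<bar>u' \<bullet> v'\<bar> \<le> sin s * sin t"
      using Cauchy_Schwarz_ineq2[of u' v'] by simp
    then have "cos (s + t) \<le> u \<bullet> v" using uv by (simp add: cos_add)
    then have "arccos (u \<bullet> v) \<le> arccos (cos (s + t))"
      using b by (intro arccos_le_arccos) auto
    also have "\<dots> = s + t" using True st by (intro arccos_cos) auto
    finally show ?thesis by (simp add: s_def t_def)
  qed
qed

lemma unit_eq_iff_inner:
  fixes u v :: "'a::real_inner"
  assumes "norm u = 1" "norm v = 1"
  shows "u \<bullet> v = 1 \<longleftrightarrow> u = v"
proof
  assume "u \<bullet> v = 1"
  moreover have "(u - v) \<bullet> (u - v) = u \<bullet> u - 2 * (u \<bullet> v) + v \<bullet> v"
    by (simp only: inner_diff inner_commute[of v u])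
  ultimately have "(u - v) \<bullet> (u - v) = 0"
    using assms by (simp add: dot_square_norm del: inner_eq_zero_iff)
  then show "u = v" by simp
qed (use assms in \<open>simp add: dot_square_norm\<close>)

text \<open>Spherical linear interpolation, with \<open>t\<close> the arc length from
  \<open>u\<close>. For unit vectors it is meaningful only if \<open>u\<close> is neither
  \<open>v\<close> nor \<open>- v\<close>, since otherwise \<open>sin d = 0\<close>.\<close>

definition great_arc :: "'a::real_inner \<Rightarrow> 'a \<Rightarrow> real \<Rightarrow> 'a" where
  "great_arc u v t = (let d = arccos (u \<bullet> v) in
     (sin (d - t) / sin d) *\<^sub>R u + (sin t / sin d) *\<^sub>R v)"

context
  fixes u v :: "'a::real_inner" and d :: real
  assumes u: "norm u = 1" and v: "norm v = 1" and d: "d = arccos (u \<bullet> v)" "0 < d" "d < pi"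
begin

lemma sin_arc_pos: "0 < sin d"
  using d by (simp add: sin_gt_zero)

lemma cos_arc: "cos d = u \<bullet> v"
  using Cauchy_Schwarz_ineq2[of u v] u v by (simp add: d cos_arccos_abs)

lemma great_arc_0: "great_arc u v 0 = u"
  using sin_arc_pos by (simp add: great_arc_def flip: d(1))

lemma great_arc_end: "great_arc u v d = v"
  using sin_arc_pos by (simp add: great_arc_def flip: d(1))

text \<open>Multiplying by \<open>(sin d)\<^sup>2\<close> clears the denominators and leaves an
  identity that follows from the addition formulas. The case \<open>s = t\<close> gives unit norm,
  the general case the arc length parametrization.\<close>

lemma inner_great_arc: "great_arc u v s \<bullet> great_arc u v t = cos (s - t)"
proof -
  have arc: "sin d *\<^sub>R great_arc u v r = sin (d - r) *\<^sub>R u + sin r *\<^sub>R v" for r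
    using sin_arc_pos by (simp add: great_arc_def Let_def scaleR_add_right flip: d(1))
  have "great_arc u v s \<bullet> great_arc u v t * (sin d)\<^sup>2 =
      (sin d *\<^sub>R great_arc u v s) \<bullet> (sin d *\<^sub>R great_arc u v t)"
    by (simp add: power2_eq_square)
  also have "\<dots> = sin (d - s) * sin (d - t) + sin s * sin t
      + cos d * (sin (d - s) * sin t + sin s * sin (d - t))"
    unfolding arc using u v
    by (simp add: inner_add inner_commute[of v u] dot_square_norm cos_arc algebra_simps)
  also have "\<dots> = cos (s - t) * (sin d)\<^sup>2"
  proof -
    have "(sin d)\<^sup>2 + (cos d)\<^sup>2 = 1" by simp
    then show ?thesis unfolding sin_diff cos_diff by algebra
  qed
  finally show ?thesis using sin_arc_pos by simp
qed

lemma norm_great_arc: "norm (great_arc u v t) = 1"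
  by (simp add: norm_eq_sqrt_inner inner_great_arc)

text \<open>Equality case of the triangle inequality: by the addition formula for
  \<open>sin\<close>, the inner product of \<open>z\<close> with the point of the arc is 1.\<close>

lemma great_arc_unique:
  assumes z: "norm z = 1" and "u \<bullet> z = cos t" "z \<bullet> v = cos (d - t)"
  shows "z = great_arc u v t"
proof -
  have "sin (d - t) * cos t + sin t * cos (d - t) = sin d"
    using sin_add[of "d - t" t] by (simp add: mult.commute)
  then have "great_arc u v t \<bullet> z = 1"
    using sin_arc_pos assms
    by (simp add: great_arc_def Let_def inner_add inner_commute[of v] mult.commute
        flip: d(1) add_divide_distrib)
  then show ?thesis using unit_eq_iff_inner norm_great_arc z by metis
qed

end

section \<open>The angular metric on \<open>S3\<close>\<close>

lemma sphere_dist_commute: "sphere_dist u v = sphere_dist v u"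
  by (simp add: sphere_dist_def inner_commute)

lemma abs_inner_S3:
  assumes "u \<in> S3" "v \<in> S3"
  shows "\<bar>u \<bullet> v\<bar> \<le> 1"
  using Cauchy_Schwarz_ineq2[of u v] assms by simp

lemma cos_sphere_dist:
  assumes "u \<in> S3" "v \<in> S3"
  shows "cos (sphere_dist u v) = u \<bullet> v"
  using abs_inner_S3[OF assms] by (simp add: sphere_dist_def cos_arccos_abs)

lemma sphere_dist_bounds:
  assumes "u \<in> S3" "v \<in> S3"
  shows "0 \<le> sphere_dist u v" "sphere_dist u v \<le> pi"
  using abs_inner_S3[OF assms]
  by (auto simp: sphere_dist_def abs_le_iff intro!: arccos_lbound arccos_ubound)

text \<open>Since \<open>arccos\<close> is decreasing, nearest sites are maximizers of an inner
  product, which linear maps can control.\<close>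

lemma sphere_dist_le_iff:
  assumes "u \<in> S3" "v \<in> S3" "u' \<in> S3" "v' \<in> S3"
  shows "sphere_dist u v \<le> sphere_dist u' v' \<longleftrightarrow> u' \<bullet> v' \<le> u \<bullet> v"
  using abs_inner_S3[OF assms(1,2)] abs_inner_S3[OF assms(3,4)]
  by (simp add: sphere_dist_def arccos_le_mono)

lemma sphere_dist_triangle:
  assumes "u \<in> S3" "v \<in> S3" "z \<in> S3"
  shows "sphere_dist u v \<le> sphere_dist u z + sphere_dist z v"
  unfolding sphere_dist_def using assms by (intro arccos_inner_triangle) auto

lemma sphere_dist_eq_0_iff:
  assumes "u \<in> S3" "v \<in> S3"
  shows "sphere_dist u v = 0 \<longleftrightarrow> u = v"
proof
  assume "sphere_dist u v = 0"
  then show "u = v" using unit_eq_iff_inner[of u v] cos_sphere_dist[OF assms] assms by simp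
next
  assume "u = v"
  then show "sphere_dist u v = 0"
    using assms by (simp add: sphere_dist_def dot_square_norm)
qed

lemma sphere_dist_pi:
  assumes "u \<in> S3" "v \<in> S3" "sphere_dist u v = pi"
  shows "u = - v"
  using unit_eq_iff_inner[of u "- v"] cos_sphere_dist[OF assms(1,2)] assms by auto

section \<open>The action and the lens metric\<close>

lemma inner_mult_unit:
  fixes c z w :: complex
  assumes "norm c = 1"
  shows "(c * z) \<bullet> (c * w) = z \<bullet> w"
proof -
  have "(c * z) \<bullet> (c * w) = ((Re c)\<^sup>2 + (Im c)\<^sup>2) * (z \<bullet> w)"
    by (simp add: inner_complex_def algebra_simps power2_eq_square)
  then show ?thesis using assms by (simp flip: cmod_power2)
qed

lemma lens_gen_inner: "lens_gen p q u \<bullet> lens_gen p q v = u \<bullet> v"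
  by (cases u; cases v)
    (simp add: lens_gen_def inner_mult_unit norm_power)

lemma lens_gen_pow_inner: "(lens_gen p q ^^ k) u \<bullet> (lens_gen p q ^^ k) v = u \<bullet> v"
  by (induction k) (simp_all add: lens_gen_inner)

lemma lens_gen_pow_sphere_dist:
  "sphere_dist ((lens_gen p q ^^ k) u) ((lens_gen p q ^^ k) v) = sphere_dist u v"
  by (simp add: sphere_dist_def lens_gen_pow_inner)

lemma norm_lens_gen_pow [simp]: "norm ((lens_gen p q ^^ k) v) = norm v"
  by (simp add: norm_eq_sqrt_inner lens_gen_pow_inner)

lemma lens_gen_pow:
  "(lens_gen p q ^^ k) (z, w) =
     (cis (2 * pi / real p) ^ k * z, cis (2 * pi / real p) ^ (q * k) * w)"
  by (induction k) (simp_all add: lens_gen_def power_add algebra_simps)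

lemma cis_root_pow_eq_1_iff:
  assumes "0 < p"
  shows "cis (2 * pi / real p) ^ k = 1 \<longleftrightarrow> p dvd k"
proof
  assume "cis (2 * pi / real p) ^ k = 1"
  then have "cos (real k * (2 * pi / real p)) = 1"
    by (metis Complex.DeMoivre cis.simps(1) one_complex.simps(1))
  then obtain n :: int where "real k * (2 * pi / real p) = of_int n * 2 * pi"
    by (auto simp: cos_one_2pi_int)
  then have "real k = of_int n * real p"
    using assms by (simp add: field_simps)
  then have "int k = n * int p" by (metis of_int_eq_iff of_int_mult of_int_of_nat_eq)
  then show "p dvd k" by (metis dvd_triv_right int_dvd_int_iff)
next
  assume "p dvd k"
  then obtain m where "k = p * m" ..
  moreover have "cis (2 * pi / real p) ^ p = 1"
    using assms by (simp add: Complex.DeMoivre)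
  ultimately show "cis (2 * pi / real p) ^ k = 1" by (simp add: power_mult)
qed

lemma lens_gen_pow_dvd:
  assumes "0 < p" "p dvd k"
  shows "(lens_gen p q ^^ k) v = v"
  using assms by (cases v) (simp add: lens_gen_pow cis_root_pow_eq_1_iff)

text \<open>The action is free off the origin. A nonzero first coordinate gives
  \<open>p dvd k\<close> at once; a nonzero second one gives \<open>p dvd q * k\<close>, where
  coprimality removes \<open>q\<close>.\<close>

lemma lens_gen_pow_free:
  assumes "0 < p" "coprime p q" "v \<noteq> 0" "(lens_gen p q ^^ k) v = v"
  shows "(lens_gen p q ^^ k) u = u"
proof -
  have "p dvd k"
  proof (cases v)
    case (Pair z w)
    then have "z \<noteq> 0 \<or> w \<noteq> 0" using assms by (auto simp: zero_prod_def)
    then show ?thesis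
      using assms Pair by (auto simp: lens_gen_pow cis_root_pow_eq_1_iff coprime_dvd_mult_right_iff)
  qed
  then show ?thesis using assms lens_gen_pow_dvd by blast
qed

text \<open>Orbits are indexed by natural exponents, so the inverse is written as the power
  \<open>(p - 1) * k\<close>; the exponents add up to \<open>p * k\<close>.\<close>

lemma lens_gen_pow_inverse:
  assumes "0 < p"
  shows "\<exists>j. \<forall>v. (lens_gen p q ^^ j) ((lens_gen p q ^^ k) v) = v"
proof -
  have "(lens_gen p q ^^ ((p - 1) * k)) ((lens_gen p q ^^ k) v) = v" for v
  proof -
    have "(p - 1) * k + k = p * k" using assms by (cases p) auto
    then show ?thesis using lens_gen_pow_dvd[OF assms, of "p * k" q v]
      by (metis comp_apply dvd_triv_left funpow_add)
  qed
  then show ?thesis by blast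
qed

section \<open>Orbits of the cyclic action\<close>

lemma lens_proj_self [simp]: "v \<in> lens_proj p q v"
  using range_eqI[of v "\<lambda>k. (lens_gen p q ^^ k) v" 0] by (simp add: lens_proj_def)

lemma lens_proj_eq:
  assumes "0 < p" "u \<in> lens_proj p q v"
  shows "lens_proj p q u = lens_proj p q v"
proof -
  obtain k where k: "u = (lens_gen p q ^^ k) v" using assms by (auto simp: lens_proj_def)
  obtain j where j: "v = (lens_gen p q ^^ j) u" using lens_gen_pow_inverse[OF assms(1)] k by metis
  have "lens_proj p q ((lens_gen p q ^^ i) z) \<subseteq> lens_proj p q z" for i z
  proof -
    have "(lens_gen p q ^^ m) ((lens_gen p q ^^ i) z) = (lens_gen p q ^^ (m + i)) z" for m
      by (simp add: funpow_add)
    then show ?thesis unfolding lens_proj_def by (metis (no_types, lifting) image_subsetI rangeI)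
  qed
  then show ?thesis using j k by (metis subset_antisym)
qed

lemma lens_proj_finite:
  assumes "0 < p"
  shows "finite (lens_proj p q v)"
proof -
  have "(lens_gen p q ^^ k) v = (lens_gen p q ^^ (k mod p)) v" for k
  proof -
    have "(lens_gen p q ^^ (k mod p + p * (k div p))) v = (lens_gen p q ^^ (k mod p)) v"
      unfolding funpow_add comp_apply using lens_gen_pow_dvd[OF assms] by simp
    then show ?thesis by simp
  qed
  then have "lens_proj p q v \<subseteq> (\<lambda>k. (lens_gen p q ^^ k) v) ` {..<p}"
    using assms by (auto simp: lens_proj_def intro!: image_eqI[where x = "_ mod p"])
  then show ?thesis using finite_surj by blast
qed

section \<open>The distance between orbits as a minimum over lifts\<close>

context
  fixes p q :: nat
  assumes p: "0 < p"
begin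

lemma lens_spaceE:
  assumes "Y \<in> lens_space p q" "v \<in> Y"
  shows "v \<in> S3" "Y = lens_proj p q v"
proof -
  obtain z where z: "z \<in> S3" "Y = lens_proj p q z" using assms by (auto simp: lens_space_def)
  then show "Y = lens_proj p q v" using lens_proj_eq[OF p] assms by metis
  show "v \<in> S3" using z assms by (auto simp: lens_proj_def)
qed

lemma lens_space_nonempty: "Y \<in> lens_space p q \<Longrightarrow> Y \<noteq> {}"
  unfolding lens_space_def using lens_proj_self by (metis emptyE imageE)

lemma lens_proj_in_lens_space: "v \<in> S3 \<Longrightarrow> lens_proj p q v \<in> lens_space p q"
  by (auto simp: lens_space_def)

context
  fixes X Y assumes X: "X \<in> lens_space p q" and Y: "Y \<in> lens_space p q"
begin

lemma finite_lens_dists: "finite ((\<lambda>(u, v). sphere_dist u v) ` (X \<times> Y))"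
  using lens_proj_finite[OF p] X Y by (auto simp: lens_space_def)

lemma lens_dist_le:
  assumes "u \<in> X" "v \<in> Y"
  shows "lens_dist X Y \<le> sphere_dist u v"
  unfolding lens_dist_def
  using assms finite_lens_dists
  by (intro cInf_lower bdd_below_finite) auto

text \<open>The infimum over finitely many pairs is a minimum, and the group moves a minimizing pair
  isometrically until its second point is the prescribed \<open>v\<close>.\<close>

lemma lens_dist_attained:
  assumes "v \<in> Y"
  shows "\<exists>u\<in>X. sphere_dist u v = lens_dist X Y"
proof -
  have "(\<lambda>(u, v). sphere_dist u v) ` (X \<times> Y) \<noteq> {}"
    using lens_space_nonempty X Y by auto
  then have "lens_dist X Y \<in> (\<lambda>(u, v). sphere_dist u v) ` (X \<times> Y)"
    unfolding lens_dist_def using finite_lens_dists by (metis Min_in cInf_eq_Min)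
  then obtain u v' where uv: "u \<in> X" "v' \<in> Y" "lens_dist X Y = sphere_dist u v'" by auto
  obtain k where k: "v = (lens_gen p q ^^ k) v'"
    using lens_spaceE[OF Y uv(2)] assms by (auto simp: lens_proj_def)
  have "(lens_gen p q ^^ k) u \<in> X"
    using lens_spaceE[OF X uv(1)] by (auto simp: lens_proj_def)
  then show ?thesis
    using uv k lens_gen_pow_sphere_dist by metis
qed

end

lemma lens_dist_commute: "lens_dist X Y = lens_dist Y X"
proof -
  have "(\<lambda>(u, v). sphere_dist u v) ` (X \<times> Y) =
      (\<lambda>(u, v). sphere_dist u v) ` prod.swap ` (Y \<times> X)"
    by (simp only: product_swap)
  also have "\<dots> = (\<lambda>(u, v). sphere_dist u v) ` (Y \<times> X)"
    by (simp add: image_image case_prod_unfold sphere_dist_commute)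
  finally show ?thesis by (simp add: lens_dist_def)
qed

lemma lens_dist_triangle:
  assumes "X \<in> lens_space p q" "Y \<in> lens_space p q" "Z \<in> lens_space p q"
  shows "lens_dist X Z \<le> lens_dist X Y + lens_dist Y Z"
proof -
  \<comment> \<open>The lifts are chosen backwards from \<open>Z\<close>, so that both distances are
    realized at the same lift \<open>y\<close>.\<close>
  obtain z where z: "z \<in> Z" using lens_space_nonempty assms by blast
  obtain y where y: "y \<in> Y" "sphere_dist y z = lens_dist Y Z"
    using lens_dist_attained[OF assms(2,3) z] by blast
  obtain x where x: "x \<in> X" "sphere_dist x y = lens_dist X Y"
    using lens_dist_attained[OF assms(1,2) y(1)] by blast
  have "sphere_dist x z \<le> sphere_dist x y + sphere_dist y z"
    using lens_spaceE(1)[OF assms(1) x(1)] lens_spaceE(1)[OF assms(2) y(1)]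
      lens_spaceE(1)[OF assms(3) z] by (intro sphere_dist_triangle)
  then show ?thesis using lens_dist_le[OF assms(1,3) x(1) z] x y by simp
qed

text \<open>This links the Voronoi diagram upstairs to the metric of the quotient.\<close>

lemma nearest_sites_iff:
  assumes "X \<in> lens_space p q" "v \<in> S3"
  shows "u \<in> nearest_sites X v \<longleftrightarrow> u \<in> X \<and> sphere_dist u v = lens_dist X (lens_proj p q v)"
proof -
  have Y: "lens_proj p q v \<in> lens_space p q" using assms lens_proj_in_lens_space by blast
  obtain u' where "u' \<in> X" "sphere_dist u' v = lens_dist X (lens_proj p q v)"
    using lens_dist_attained[OF assms(1) Y lens_proj_self] by blast
  moreover have "lens_dist X (lens_proj p q v) \<le> sphere_dist w v" if "w \<in> X" for w
    using lens_dist_le[OF assms(1) Y that lens_proj_self] .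
  ultimately show ?thesis
    unfolding nearest_sites_def mem_Collect_eq by (metis order.antisym)
qed

section \<open>Shortest geodesics\<close>

text \<open>At distance \<open>pi\<close> from \<open>v\<close>, every lift of \<open>X\<close>
  would be the antipode \<open>- v\<close>. The bound keeps great arcs nondegenerate.\<close>

lemma lens_dist_less_pi:
  assumes X: "X \<in> lens_space p q" and Y: "Y \<in> lens_space p q" and "u \<in> X" "u' \<in> X" "u \<noteq> u'"
  shows "lens_dist X Y < pi"
proof (rule ccontr)
  assume *: "\<not> lens_dist X Y < pi"
  obtain v where v: "v \<in> Y" using lens_space_nonempty Y by blast
  have "y = - v" if "y \<in> X" for y
  proof -
    have S: "y \<in> S3" "v \<in> S3" using lens_spaceE(1) X Y that v by blast+
    show ?thesis
      using lens_dist_le[OF X Y that v] * sphere_dist_bounds(2)[OF S] sphere_dist_pi[OF S] by simp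
  qed
  then show False using assms by metis
qed

text \<open>Projection does not increase distances, so the projected arc moves with speed at most 1;
  as its ends are \<open>d\<close> apart, no part of it can be shortened.\<close>

lemma shortest_geodesic_great_arc:
  assumes X: "X \<in> lens_space p q" and v: "v \<in> S3" and u: "u \<in> nearest_sites X v"
    and d: "d = lens_dist X (lens_proj p q v)" "0 < d" "d < pi"
  shows "shortest_geodesic p q X (lens_proj p q v) (\<lambda>t. lens_proj p q (great_arc u v t))"
proof -
  let ?\<gamma> = "\<lambda>t. lens_proj p q (great_arc u v t)"
  have uX: "u \<in> X" and uv: "d = sphere_dist u v"
    using u nearest_sites_iff[OF X v] d by auto
  have nu: "norm u = 1" "norm v = 1" "X = lens_proj p q u"
    using lens_spaceE[OF X uX] v by auto
  have d': "d = arccos (u \<bullet> v)" using uv by (simp add: sphere_dist_def)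
  note arc = nu(1,2) d' d(2,3)
  have S: "great_arc u v t \<in> S3" for t using norm_great_arc[OF arc] by simp
  have L: "?\<gamma> t \<in> lens_space p q" for t using S lens_proj_in_lens_space by blast
  have ends: "?\<gamma> 0 = X" "?\<gamma> d = lens_proj p q v"
    using great_arc_0[OF arc] great_arc_end[OF arc] nu by auto
  have le: "lens_dist (?\<gamma> s) (?\<gamma> t) \<le> t - s" if "0 \<le> s" "s \<le> t" "t \<le> d" for s t
  proof -
    have "sphere_dist (great_arc u v s) (great_arc u v t) = arccos (cos (t - s))"
      unfolding sphere_dist_def inner_great_arc[OF arc] by (metis cos_minus minus_diff_eq)
    also have "\<dots> = t - s" using that d by (intro arccos_cos) auto
    finally show ?thesis using lens_dist_le[OF L L] lens_proj_self by metis
  qed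
  have tri: "lens_dist (?\<gamma> r) (?\<gamma> t) \<le> lens_dist (?\<gamma> r) (?\<gamma> s) + lens_dist (?\<gamma> s) (?\<gamma> t)"
    for r s t by (rule lens_dist_triangle[OF L L L])
  \<comment> \<open>Passing from \<open>X\<close> to the other end through parameters
    \<open>s\<close> and \<open>t\<close> gives
    \<open>d \<le> s + lens_dist (?\<gamma> s) (?\<gamma> t) + (d - t)\<close>.\<close>
  have eq: "lens_dist (?\<gamma> s) (?\<gamma> t) = t - s" if "0 \<le> s" "s \<le> t" "t \<le> d" for s t
    using le[OF that] le[of 0 s] le[of t d] that tri[of 0 d s] tri[of s d t]
    unfolding ends d(1)[symmetric] by linarith
  have "lens_dist (?\<gamma> s) (?\<gamma> t) = \<bar>s - t\<bar>" if "s \<in> {0..d}" "t \<in> {0..d}" for s t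
    using eq[of s t] eq[of t s] that lens_dist_commute[of "?\<gamma> s" "?\<gamma> t"] by (cases "s \<le> t") auto
  then show ?thesis unfolding shortest_geodesic_def d(1)[symmetric] using ends L by auto
qed

text \<open>Near \<open>v\<close>, the arcs to \<open>v\<close> from two different sites are too close to each other for a
  nontrivial element of the group to identify their points.\<close>

lemma great_arcs_differ:
  assumes cop: "coprime p q" and X: "X \<in> lens_space p q" and v: "v \<in> S3"
    and u: "u \<in> nearest_sites X v" "u' \<in> nearest_sites X v" "u \<noteq> u'"
    and d: "d = lens_dist X (lens_proj p q v)" "0 < d" "d < pi"
  shows "\<exists>t\<in>{0..d}. lens_proj p q (great_arc u v t) \<noteq> lens_proj p q (great_arc u' v t)"
proof -
  \<comment> \<open>The distances from \<open>v\<close> to its other translates; \<open>d\<close> is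
    added so that the minimum exists and bounds \<open>e\<close> below \<open>d\<close>.\<close>
  define D where "D = insert d ((\<lambda>y. sphere_dist v y) ` (lens_proj p q v - {v}))"
  have fD: "finite D" "D \<noteq> {}" using lens_proj_finite[OF p] by (auto simp: D_def)
  have Y: "lens_proj p q v \<in> lens_space p q" using v lens_proj_in_lens_space by blast
  have "0 < sphere_dist v y" if "y \<in> lens_proj p q v - {v}" for y
  proof -
    have "y \<in> S3" using lens_spaceE(1)[OF Y] that by blast
    then show ?thesis
      using that sphere_dist_bounds(1)[OF v, of y] sphere_dist_eq_0_iff[OF v, of y] by auto
  qed
  then have "0 < y" if "y \<in> D" for y
    using that d(2) unfolding D_def by blast
  then have pos: "0 < Min D" using fD by simp
  \<comment> \<open>With a third of the minimum, a displacement of \<open>v\<close> by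
    \<open>2 * e\<close> is still too short to reach another translate.\<close>
  define e where "e = Min D / 3"
  define t where "t = d - e"
  have "Min D \<le> d" using fD by (simp add: D_def)
  then have e: "0 < e" "e < d" using pos by (auto simp: e_def)
  then have t: "t \<in> {0..d}" by (auto simp: t_def)
  have nv: "norm v = 1" using v by simp
  have site: "y \<in> S3" "d = sphere_dist y v" if "y \<in> nearest_sites X v" for y
    using that nearest_sites_iff[OF X v] d(1) lens_spaceE(1)[OF X] by metis+
  have nuu: "norm u = 1" "norm u' = 1" "d = arccos (u \<bullet> v)" "d = arccos (u' \<bullet> v)"
    using site[OF u(1)] site[OF u(2)] by (simp_all flip: sphere_dist_def)
  note arc = nuu(1) nv nuu(3) d(2,3) and arc' = nuu(2) nv nuu(4) d(2,3)
  have S: "great_arc u v t \<in> S3" "great_arc u' v t \<in> S3"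
    using norm_great_arc[OF arc] norm_great_arc[OF arc'] by auto
  have "great_arc u v t \<bullet> v = cos e"
    using inner_great_arc[OF arc, of t d] great_arc_end[OF arc] by (simp add: t_def)
  then have 1: "sphere_dist (great_arc u v t) v = e"
    using e d(3) by (simp add: sphere_dist_def arccos_cos)
  have "great_arc u' v t \<bullet> v = cos e"
    using inner_great_arc[OF arc', of t d] great_arc_end[OF arc'] by (simp add: t_def)
  then have 2: "sphere_dist (great_arc u' v t) v = e"
    using e d(3) by (simp add: sphere_dist_def arccos_cos)
  have "lens_proj p q (great_arc u v t) \<noteq> lens_proj p q (great_arc u' v t)"
  proof
    assume "lens_proj p q (great_arc u v t) = lens_proj p q (great_arc u' v t)"
    then have "great_arc u v t \<in> lens_proj p q (great_arc u' v t)"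
      by (metis lens_proj_self)
    then obtain k where k: "great_arc u v t = (lens_gen p q ^^ k) (great_arc u' v t)"
      by (auto simp: lens_proj_def)
    have gv: "(lens_gen p q ^^ k) v \<in> lens_proj p q v" by (auto simp: lens_proj_def)
    have gS: "(lens_gen p q ^^ k) v \<in> S3" using v by simp
    \<comment> \<open>The first arc point is at distance \<open>e\<close> from \<open>v\<close> and,
      being the translate of the second, also at distance \<open>e\<close> from the translate of
      \<open>v\<close>.\<close>
    have "sphere_dist v ((lens_gen p q ^^ k) v) \<le>
        sphere_dist v (great_arc u v t) + sphere_dist (great_arc u v t) ((lens_gen p q ^^ k) v)"
      using v S gS by (intro sphere_dist_triangle)
    also have "\<dots> = 2 * e"
      using 1 2 unfolding sphere_dist_commute[of v]
      by (subst (2) k) (simp add: lens_gen_pow_sphere_dist)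
    also have "\<dots> < Min D" using pos by (simp add: e_def)
    finally have "sphere_dist v ((lens_gen p q ^^ k) v) \<notin> D"
      using fD by (meson Min_le not_le)
    then have "(lens_gen p q ^^ k) v = v" using gv by (auto simp: D_def)
    then have "great_arc u v t = great_arc u' v t"
      using lens_gen_pow_free[OF p cop] k nv by (metis norm_zero zero_neq_one)
    \<comment> \<open>Both arc points have the same \<open>v\<close> term, which cancels.\<close>
    then have "sin (d - t) *\<^sub>R u = sin (d - t) *\<^sub>R u'"
      using sin_arc_pos[OF arc] by (simp add: great_arc_def flip: nuu(3,4))
    moreover have "0 < sin (d - t)" using e d(3) by (intro sin_gt_zero) (auto simp: t_def)
    ultimately show False using u by simp
  qed
  then show ?thesis using t by blast
qed

text \<open>Lift \<open>\<gamma> t\<close> to a \<open>z\<close> at distance \<open>d - t\<close>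
  from \<open>v\<close>, then pick a site \<open>u'\<close> at distance \<open>t\<close> from
  \<open>z\<close>. The triangle inequality makes \<open>u'\<close> nearest to \<open>v\<close>, and
  the equality case puts \<open>z\<close> on the arc. The case \<open>t = 0\<close> is separate
  because for \<open>d = 0\<close> the arc formula divides by zero.\<close>

lemma shortest_geodesic_unique:
  assumes X: "X \<in> lens_space p q" and v: "v \<in> S3"
    and uniq: "\<And>u'. u' \<in> nearest_sites X v \<Longrightarrow> u' = u"
    and d: "d = lens_dist X (lens_proj p q v)" "d < pi"
    and g: "shortest_geodesic p q X (lens_proj p q v) \<gamma>" and t: "t \<in> {0..d}"
  shows "\<gamma> t = (if t = 0 then X else lens_proj p q (great_arc u v t))"
proof (cases "t = 0")
  case True
  then show ?thesis using g by (simp add: shortest_geodesic_def)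
next
  case False
  then have t0: "0 < t" "t \<le> d" using t by auto
  let ?Y = "lens_proj p q v"
  have Y: "?Y \<in> lens_space p q" using v lens_proj_in_lens_space by blast
  have Z: "\<gamma> t \<in> lens_space p q" using g t unfolding shortest_geodesic_def d(1) by auto
  have dist: "lens_dist (\<gamma> r) (\<gamma> s) = \<bar>r - s\<bar>" if "r \<in> {0..d}" "s \<in> {0..d}" for r s
    using g that unfolding shortest_geodesic_def d(1) by blast
  have ends: "\<gamma> 0 = X" "\<gamma> d = ?Y" using g unfolding shortest_geodesic_def d(1) by auto
  have XZ: "lens_dist X (\<gamma> t) = t" and ZY: "lens_dist (\<gamma> t) ?Y = d - t"
    using dist[of 0 t] dist[of t d] t0 unfolding ends by auto
  obtain z where z: "z \<in> \<gamma> t" "sphere_dist z v = d - t"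
    using lens_dist_attained[OF Z Y lens_proj_self] ZY by auto
  obtain u' where u': "u' \<in> X" "sphere_dist u' z = t"
    using lens_dist_attained[OF X Z z(1)] XZ by auto
  have zS: "z \<in> S3" "\<gamma> t = lens_proj p q z" and uS: "u' \<in> S3"
    using lens_spaceE[OF Z z(1)] lens_spaceE[OF X u'(1)] by auto
  have "sphere_dist u' v \<le> d" using sphere_dist_triangle[OF uS v zS(1)] z u' by simp
  then have u'd: "sphere_dist u' v = d"
    using lens_dist_le[OF X Y u'(1) lens_proj_self] d by simp
  then have "u' = u" using uniq nearest_sites_iff[OF X v] u' d by blast
  moreover have "z = great_arc u' v t"
  proof (rule great_arc_unique)
    show "d = arccos (u' \<bullet> v)" using u'd by (simp add: sphere_dist_def)
    show "u' \<bullet> z = cos t" "z \<bullet> v = cos (d - t)"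
      using cos_sphere_dist[OF uS zS(1)] cos_sphere_dist[OF zS(1) v] z(2) u'(2) by simp_all
  qed (use t0 d uS zS v in auto)
  ultimately show ?thesis using zS False by simp
qed

text \<open>A single nearest site determines every value of a shortest geodesic; two sites give two
  projected arcs that differ. The points \<open>y\<close> and \<open>y'\<close> serve to keep the
  distance below \<open>pi\<close>.\<close>

lemma nonunique_geodesic_iff:
  assumes cop: "coprime p q" and X: "X \<in> lens_space p q" and v: "v \<in> S3"
    and two: "y \<in> X" "y' \<in> X" "y \<noteq> y'"
  shows "(\<exists>\<gamma> \<gamma>'. shortest_geodesic p q X (lens_proj p q v) \<gamma> \<and>
        shortest_geodesic p q X (lens_proj p q v) \<gamma>' \<and>
        (\<exists>t\<in>{0..lens_dist X (lens_proj p q v)}. \<gamma> t \<noteq> \<gamma>' t)) \<longleftrightarrow>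
     (\<exists>u\<in>nearest_sites X v. \<exists>u'\<in>nearest_sites X v. u \<noteq> u')"
    (is "?L = ?R")
proof
  let ?d = "lens_dist X (lens_proj p q v)"
  have Y: "lens_proj p q v \<in> lens_space p q" using v lens_proj_in_lens_space by blast
  have d: "?d < pi" using lens_dist_less_pi X Y two by blast
  show ?R if ?L
  proof (rule ccontr)
    assume "\<not> ?R"
    then obtain u where "\<And>u'. u' \<in> nearest_sites X v \<Longrightarrow> u' = u" by metis
    from shortest_geodesic_unique[OF X v this refl d] that show False by metis
  qed
  show ?L if sites: ?R
  proof -
    obtain u u' where u: "u \<in> nearest_sites X v" "u' \<in> nearest_sites X v" "u \<noteq> u'"
      using sites by blast
    \<comment> \<open>At distance 0 both sites would coincide with \<open>v\<close>, so distinct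
      sites force a positive distance.\<close>
    then have "0 \<le> ?d" "?d = 0 \<longrightarrow> u = v \<and> u' = v"
      using nearest_sites_iff[OF X v] sphere_dist_bounds(1)[of u v] sphere_dist_eq_0_iff[of _ v] v
        lens_spaceE(1)[OF X] by metis+
    then have "0 < ?d" using u by auto
    then show ?L
      using shortest_geodesic_great_arc[OF X v _ refl _ d] great_arcs_differ[OF cop X v u refl _ d] u
      by blast
  qed
qed

end

section \<open>Diagonal maps\<close>

definition diag_map :: "complex \<Rightarrow> complex \<Rightarrow> complex \<times> complex \<Rightarrow> complex \<times> complex" where
  "diag_map a b = (\<lambda>(z, w). (a * z, b * w))"

text \<open>The linear map followed by radial projection, since \<open>diag_map\<close> alone need
  not preserve the sphere.\<close>

definition diag_sphere :: "complex \<Rightarrow> complex \<Rightarrow> complex \<times> complex \<Rightarrow> complex \<times> complex" where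
  "diag_sphere a b v = sgn (diag_map a b v)"

lemma diag_map_pair [simp]: "diag_map a b (z, w) = (a * z, b * w)"
  by (simp add: diag_map_def)

lemma diag_map_scaleR: "diag_map a b (r *\<^sub>R v) = r *\<^sub>R diag_map a b v"
  by (cases v) simp

lemma diag_map_mult: "diag_map a b (diag_map c d v) = diag_map (a * c) (b * d) v"
  by (cases v) (simp add: mult.assoc)

lemma diag_map_1 [simp]: "diag_map 1 1 v = v"
  by (cases v) simp

lemma diag_map_eq_0_iff: "a \<noteq> 0 \<Longrightarrow> b \<noteq> 0 \<Longrightarrow> diag_map a b v = 0 \<longleftrightarrow> v = 0"
  by (cases v) (simp add: zero_prod_def)

lemma diag_map_lens_gen_pow:
  "diag_map a b ((lens_gen p q ^^ k) v) = (lens_gen p q ^^ k) (diag_map a b v)"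
  by (cases v) (simp add: lens_gen_pow algebra_simps)

lemma lens_gen_pow_scaleR: "(lens_gen p q ^^ k) (r *\<^sub>R v) = r *\<^sub>R (lens_gen p q ^^ k) v"
  by (cases v) (simp add: lens_gen_pow)

lemma diag_sphere_lens_gen_pow:
  "diag_sphere a b ((lens_gen p q ^^ k) v) = (lens_gen p q ^^ k) (diag_sphere a b v)"
  by (simp add: diag_sphere_def diag_map_lens_gen_pow sgn_div_norm lens_gen_pow_scaleR
      norm_eq_sqrt_inner lens_gen_pow_inner)

lemma diag_map_lens_proj: "diag_map a b ` lens_proj p q v = lens_proj p q (diag_map a b v)"
  by (simp add: lens_proj_def image_image diag_map_lens_gen_pow)

lemma diag_sphere_lens_proj: "diag_sphere a b ` lens_proj p q v = lens_proj p q (diag_sphere a b v)"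
  by (simp add: lens_proj_def image_image diag_sphere_lens_gen_pow)

lemma diag_sphere_S3:
  assumes "a \<noteq> 0" "b \<noteq> 0" "v \<in> S3"
  shows "diag_sphere a b v \<in> S3"
proof -
  have "v \<noteq> 0" using assms by auto
  then show ?thesis using assms by (simp add: diag_sphere_def norm_sgn diag_map_eq_0_iff)
qed

text \<open>The first normalization only contributes a positive scalar, which the second one
  removes.\<close>

lemma diag_sphere_inverse:
  assumes "a \<noteq> 0" "b \<noteq> 0" "v \<in> S3"
  shows "diag_sphere (inverse a) (inverse b) (diag_sphere a b v) = v"
proof -
  have "diag_map a b v \<noteq> 0" using assms diag_map_eq_0_iff[of a b v] by auto
  then show ?thesis
    using assms by (simp add: diag_sphere_def sgn_div_norm diag_map_scaleR diag_map_mult)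
qed

lemma diag_sphere_continuous:
  assumes "a \<noteq> 0" "b \<noteq> 0"
  shows "continuous_on S3 (diag_sphere a b)"
proof -
  have "diag_map a b v \<noteq> 0" if "v \<in> S3" for v
    using that assms diag_map_eq_0_iff[of a b v] by auto
  moreover have "continuous_on S3 (diag_map a b)"
    unfolding diag_map_def split_def by (intro continuous_intros)
  ultimately show ?thesis
    unfolding diag_sphere_def sgn_div_norm by (auto intro!: continuous_intros)
qed

section \<open>Adjoint pairing, nearest sites and Voronoi cells\<close>

lemma inner_mult_adjoint:
  fixes a z w :: complex
  assumes "a \<noteq> 0"
  shows "(a * z) \<bullet> (inverse (cnj a) * w) = z \<bullet> w"
proof -
  have inner_Re: "x \<bullet> y = Re (x * cnj y)" for x y :: complex
    by (simp add: inner_complex_def)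
  have "a * z * cnj (inverse (cnj a) * w) = z * cnj w"
    using assms by (simp add: field_simps)
  then show ?thesis unfolding inner_Re by (rule arg_cong)
qed

text \<open>The second map is the inverse of the adjoint of the first.\<close>

lemma inner_diag_map:
  assumes "a \<noteq> 0" "b \<noteq> 0"
  shows "diag_map a b u \<bullet> diag_map (inverse (cnj a)) (inverse (cnj b)) v = u \<bullet> v"
  using assms by (cases u; cases v) (simp add: inner_mult_adjoint)

text \<open>All inner products with sites are divided by the same positive number
  \<open>norm ?L\<close>, so their order, and hence the set of maximizers, is carried over.\<close>

lemma nearest_sites_diag:
  assumes ab: "a \<noteq> 0" "b \<noteq> 0" and X: "X \<subseteq> S3" "diag_map a b ` X \<subseteq> S3" and v: "v \<in> S3"
  shows "nearest_sites (diag_map a b ` X) (diag_sphere (inverse (cnj a)) (inverse (cnj b)) v) =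
    diag_map a b ` nearest_sites X v"
proof -
  let ?L = "diag_map (inverse (cnj a)) (inverse (cnj b)) v"
  let ?P = "diag_sphere (inverse (cnj a)) (inverse (cnj b)) v"
  have pos: "norm ?L > 0" using ab v diag_map_eq_0_iff[of "inverse (cnj a)" "inverse (cnj b)" v] by auto
  have P: "?P \<in> S3" using ab v by (intro diag_sphere_S3) auto
  have inn: "diag_map a b u \<bullet> ?P = (u \<bullet> v) / norm ?L" for u
    using inner_diag_map[OF ab] by (simp add: diag_sphere_def sgn_div_norm divide_inverse mult.commute)
  have le: "sphere_dist (diag_map a b u) ?P \<le> sphere_dist (diag_map a b u') ?P \<longleftrightarrow>
      sphere_dist u v \<le> sphere_dist u' v" if "u \<in> X" "u' \<in> X" for u u'
  proof -
    have "diag_map a b u \<in> S3" "diag_map a b u' \<in> S3" "u \<in> S3" "u' \<in> S3" using that X by blast+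
    then show ?thesis using P v pos
      by (simp only: sphere_dist_le_iff inn divide_le_cancel) (auto simp: divide_le_cancel)
  qed
  have "nearest_sites (diag_map a b ` X) ?P =
      diag_map a b ` {u \<in> X. \<forall>u'\<in>X. sphere_dist (diag_map a b u) ?P \<le> sphere_dist (diag_map a b u') ?P}"
    unfolding nearest_sites_def by blast
  also have "{u \<in> X. \<forall>u'\<in>X. sphere_dist (diag_map a b u) ?P \<le> sphere_dist (diag_map a b u') ?P} =
      nearest_sites X v"
    unfolding nearest_sites_def using le by blast
  finally show ?thesis .
qed

lemma voronoi_cells_diag:
  assumes ab: "a \<noteq> 0" "b \<noteq> 0" and X: "X \<subseteq> S3" "diag_map a b ` X \<subseteq> S3"
    and F: "F \<in> voronoi_cells X"
  shows "diag_sphere (inverse (cnj a)) (inverse (cnj b)) ` F \<in> voronoi_cells (diag_map a b ` X)"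
proof -
  let ?P = "diag_sphere (inverse (cnj a)) (inverse (cnj b))"
  let ?Q = "diag_sphere (cnj a) (cnj b)"
  obtain T where T: "T \<subseteq> X" "2 \<le> card T" "F = {v \<in> S3. nearest_sites X v = T}" "F \<noteq> {}"
    using F unfolding voronoi_cells_def by (elim DiffE CollectE exE conjE) simp
  have inj: "inj (diag_map a b)"
    by (rule inj_on_inverseI[where g = "diag_map (inverse a) (inverse b)"])
      (use ab in \<open>simp add: diag_map_mult\<close>)
  have PS: "?P v \<in> S3" if "v \<in> S3" for v using ab that by (intro diag_sphere_S3) auto
  have QS: "?Q v \<in> S3" if "v \<in> S3" for v using ab that by (intro diag_sphere_S3) auto
  have PQ: "?P (?Q v) = v" if "v \<in> S3" for v using ab that by (intro diag_sphere_inverse) auto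
  have near: "nearest_sites (diag_map a b ` X) (?P v) = diag_map a b ` nearest_sites X v"
    if "v \<in> S3" for v using nearest_sites_diag[OF ab X that] .
  have "?P ` F = {v \<in> S3. nearest_sites (diag_map a b ` X) v = diag_map a b ` T}"
  proof (intro equalityI subsetI)
    fix v assume "v \<in> ?P ` F"
    then obtain w where "w \<in> S3" "nearest_sites X w = T" "v = ?P w" unfolding T(3) by blast
    then show "v \<in> {v \<in> S3. nearest_sites (diag_map a b ` X) v = diag_map a b ` T}"
      using PS[of w] near[of w] by simp
  next
    fix v assume v: "v \<in> {v \<in> S3. nearest_sites (diag_map a b ` X) v = diag_map a b ` T}"
    then have vS: "v \<in> S3" by blast
    have "diag_map a b ` nearest_sites X (?Q v) = diag_map a b ` T"
      using near[OF QS[OF vS]] v unfolding PQ[OF vS] by blast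
    then have "nearest_sites X (?Q v) = T" using inj by (simp only: inj_image_eq_iff)
    then have "?Q v \<in> F" unfolding T(3) using QS[OF vS] by blast
    then have "?P (?Q v) \<in> ?P ` F" by (rule imageI)
    then show "v \<in> ?P ` F" unfolding PQ[OF vS] .
  qed
  moreover have "card (diag_map a b ` T) = card T"
    by (rule card_image) (rule inj_on_subset[OF inj subset_UNIV])
  moreover have "?P ` F \<noteq> {}" using T(4) by simp
  moreover have "diag_map a b ` T \<subseteq> diag_map a b ` X" using T(1) by (rule image_mono)
  ultimately show ?thesis
    unfolding voronoi_cells_def using T(2)
    by (intro DiffI CollectI exI[of _ "diag_map a b ` T"]) simp_all
qed

section \<open>The homeomorphism of lens spaces\<close>

context
  fixes p q :: nat and a b :: complex
  assumes p: "0 < p" and ab: "a \<noteq> 0" "b \<noteq> 0"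
begin

text \<open>By the universal property of the quotient, continuity is checked after composing with
  \<open>lens_proj\<close>, where it reduces to that of \<open>diag_sphere\<close>.\<close>

lemma lens_diag_continuous:
  "continuous_map (lens_topology p q) (lens_topology p q) (image (diag_sphere a b))"
proof -
  have "continuous_map (top_of_set S3) (top_of_set S3) (diag_sphere a b)"
    using diag_sphere_continuous[OF ab] diag_sphere_S3[OF ab] by auto
  then have "continuous_map (top_of_set S3) (lens_topology p q) (lens_proj p q \<circ> diag_sphere a b)"
    using quotient_imp_continuous_map[OF quotient_map_lens_proj] continuous_map_compose by blast
  moreover have "lens_proj p q \<circ> diag_sphere a b = image (diag_sphere a b) \<circ> lens_proj p q"
    by (auto simp: diag_sphere_lens_proj)
  ultimately show ?thesis
    using continuous_compose_quotient_map[OF quotient_map_lens_proj] by metis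
qed

lemma lens_diag_inverse:
  assumes "Y \<in> lens_space p q"
  shows "diag_sphere (inverse a) (inverse b) ` diag_sphere a b ` Y = Y"
proof -
  have "diag_sphere (inverse a) (inverse b) (diag_sphere a b v) = v" if "v \<in> Y" for v
    using diag_sphere_inverse[OF ab] lens_spaceE(1)[OF p assms that] by blast
  then show ?thesis by (simp add: image_image)
qed

end

lemma lens_diag_homeomorphic:
  assumes "0 < p" "a \<noteq> 0" "b \<noteq> 0"
  shows "homeomorphic_map (lens_topology p q) (lens_topology p q) (image (diag_sphere a b))"
proof -
  have "homeomorphic_maps (lens_topology p q) (lens_topology p q)
      (image (diag_sphere a b)) (image (diag_sphere (inverse a) (inverse b)))"
    unfolding homeomorphic_maps_def
    using lens_diag_continuous[OF assms] lens_diag_continuous[of p "inverse a" "inverse b"]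
      lens_diag_inverse[OF assms] lens_diag_inverse[of p "inverse a" "inverse b"] assms
    by simp
  then show ?thesis using homeomorphic_maps_map by blast
qed

text \<open>Geodesics are eliminated here: the set whose closure is taken becomes the projection of
  the points of \<open>S3\<close> with several nearest sites.\<close>

lemma cut_locus_eq:
  assumes "0 < p" "coprime p q" "X \<in> lens_space p q" "y \<in> X" "y' \<in> X" "y \<noteq> y'"
  shows "cut_locus p q X = lens_topology p q closure_of
    (lens_proj p q ` {v \<in> S3. \<exists>u\<in>nearest_sites X v. \<exists>u'\<in>nearest_sites X v. u \<noteq> u'})"
proof -
  have image_Collect: "{Y \<in> f ` A. N Y} = f ` {v \<in> A. M v}"
    if "\<And>v. v \<in> A \<Longrightarrow> N (f v) \<longleftrightarrow> M v" for f :: "'a \<Rightarrow> 'b" and A N M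
    using that by blast
  show ?thesis
    unfolding cut_locus_def lens_space_def
    by (rule arg_cong[where f = "(closure_of) _"], rule image_Collect,
        rule nonunique_geodesic_iff[OF assms(1-3) _ assms(4-6)])
qed

text \<open>A vanishing coordinate leaves the other one on the unit circle, hence of the form
  \<open>cis\<close>, which is a core circle. The generator moves \<open>(a, b)\<close> because
  \<open>p > 1\<close>.\<close>

lemma lens_space_generic:
  assumes "1 < p" "X \<in> lens_space p q - (core_w p q \<union> core_z p q)"
  obtains a b where "a \<noteq> 0" "b \<noteq> 0" "(a, b) \<in> S3" "X = lens_proj p q (a, b)"
    "\<exists>y\<in>X. \<exists>y'\<in>X. y \<noteq> y'"
proof -
  obtain a b where ab: "(a, b) \<in> S3" "X = lens_proj p q (a, b)"
    using assms by (auto simp: lens_space_def simp del: mem_sphere_0)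
  have a: "a \<noteq> 0"
  proof
    assume "a = 0"
    then have "norm b = 1" using ab by (simp add: norm_Pair)
    then have "b = cis (Arg b)" using cis_Arg[of b] by (cases "b = 0") (simp_all add: sgn_div_norm)
    then have "X \<in> core_w p q" using ab \<open>a = 0\<close> unfolding core_w_def by (metis rangeI)
    then show False using assms by blast
  qed
  have b: "b \<noteq> 0"
  proof
    assume "b = 0"
    then have "norm a = 1" using ab by (simp add: norm_Pair)
    then have "a = cis (Arg a)" using cis_Arg[of a] by (cases "a = 0") (simp_all add: sgn_div_norm)
    then have "X \<in> core_z p q" using ab \<open>b = 0\<close> unfolding core_z_def by (metis rangeI)
    then show False using assms by blast
  qed
  have "(lens_gen p q ^^ 1) (a, b) \<noteq> (a, b)"
    using a assms cis_root_pow_eq_1_iff[of p 1] by (simp add: lens_gen_pow del: funpow.simps)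
  moreover have "(lens_gen p q ^^ 1) (a, b) \<in> X" unfolding ab lens_proj_def by (rule rangeI)
  ultimately show ?thesis using that a b ab lens_proj_self by metis
qed

theorem lemma4:
  fixes p q :: nat and x :: "(complex \<times> complex) set"
  assumes "0 < q" and "q < p" and "coprime p q"
    and "x \<in> lens_space p q - (core_w p q \<union> core_z p q)"
    and "simple_spine (lens_topology p q) (cut_locus p q x)"
  shows "\<forall>x' \<in> lens_space p q - (core_w p q \<union> core_z p q).
    same_combinatorial_type
      (subtopology (lens_topology p q) (cut_locus p q x)) (cut_locus_cells p q x)
      (subtopology (lens_topology p q) (cut_locus p q x')) (cut_locus_cells p q x')"
proof
  fix x' assume x': "x' \<in> lens_space p q - (core_w p q \<union> core_z p q)"
  have p: "0 < p" "1 < p" using assms by auto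
  obtain a b where ab: "a \<noteq> 0" "b \<noteq> 0" "(a, b) \<in> S3" "x = lens_proj p q (a, b)"
    and two: "\<exists>y\<in>x. \<exists>y'\<in>x. y \<noteq> y'"
    using lens_space_generic[OF p(2) assms(4)] .
  obtain a' b' where ab': "a' \<noteq> 0" "b' \<noteq> 0" "(a', b') \<in> S3" "x' = lens_proj p q (a', b')"
    and two': "\<exists>y\<in>x'. \<exists>y'\<in>x'. y \<noteq> y'"
    using lens_space_generic[OF p(2) x'] .
  \<comment> \<open>The coordinate ratios send \<open>(a, b)\<close> to \<open>(a', b')\<close>, and
    therefore orbit to orbit.\<close>
  define c where "c = a' / a"
  define d where "d = b' / b"
  have cd: "c \<noteq> 0" "d \<noteq> 0" using ab ab' by (auto simp: c_def d_def)
  have im: "diag_map c d ` x = x'"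
    using ab ab' by (simp add: diag_map_lens_proj c_def d_def)
  have im': "diag_map (inverse c) (inverse d) ` x' = x"
    using ab ab' by (simp add: diag_map_lens_proj c_def d_def)
  have xL: "x \<in> lens_space p q" "x' \<in> lens_space p q" using assms x' by auto
  have xS: "x \<subseteq> S3" "x' \<subseteq> S3" using lens_spaceE(1)[OF p(1)] xL by blast+
  define P where "P = diag_sphere (inverse (cnj c)) (inverse (cnj d))"
  define Q where "Q = diag_sphere (cnj c) (cnj d)"
  have PS: "P v \<in> S3" if "v \<in> S3" for v
    unfolding P_def using cd that by (intro diag_sphere_S3) auto
  have QS: "Q v \<in> S3" if "v \<in> S3" for v
    unfolding Q_def using cd that by (intro diag_sphere_S3) auto
  have PQ: "P (Q v) = v" if "v \<in> S3" for v
    unfolding P_def Q_def using cd that by (intro diag_sphere_inverse) auto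
  have projP: "image P (lens_proj p q v) = lens_proj p q (P v)" for v
    unfolding P_def by (rule diag_sphere_lens_proj)
  have near: "nearest_sites x' (P v) = diag_map c d ` nearest_sites x v" if "v \<in> S3" for v
    using nearest_sites_diag[OF cd xS(1) _ that] im xS(2) unfolding P_def by simp
  have inj: "diag_map c d u = diag_map c d u' \<longleftrightarrow> u = u'" for u u'
    using cd by (cases u; cases u') simp
  have PF: "P ` F \<in> voronoi_cells x'" if "F \<in> voronoi_cells x" for F
    using voronoi_cells_diag[OF cd xS(1) _ that] im xS(2) unfolding P_def by simp
  \<comment> \<open>\<open>Q\<close> arises from \<open>inverse c\<close> and
    \<open>inverse d\<close> just as \<open>P\<close> does from \<open>c\<close> and
    \<open>d\<close>, so the roles of \<open>x\<close> and \<open>x'\<close> may be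
    exchanged.\<close>
  have QF: "Q ` F \<in> voronoi_cells x" if "F \<in> voronoi_cells x'" for F
    using voronoi_cells_diag[of "inverse c" "inverse d" x' F] cd xS im' that
    unfolding Q_def by simp
  have VS: "F \<subseteq> S3" if "F \<in> voronoi_cells X" for F X
    using that by (auto simp: voronoi_cells_def simp del: mem_sphere_0)
  have PV: "image P ` voronoi_cells x = voronoi_cells x'"
  proof (intro equalityI subsetI)
    fix F assume "F \<in> image P ` voronoi_cells x"
    then show "F \<in> voronoi_cells x'" using PF by blast
  next
    fix F assume F: "F \<in> voronoi_cells x'"
    then have "P ` Q ` F = F" using PQ VS[OF F] by (force simp: image_image)
    then show "F \<in> image P ` voronoi_cells x" using QF[OF F] by (metis imageI)
  qed
  have cells: "(\<lambda>A. image P ` A) ` cut_locus_cells p q x = cut_locus_cells p q x'"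
    unfolding cut_locus_cells_def PV[symmetric] by (simp add: image_image projP)
  have hom: "homeomorphic_map (lens_topology p q) (lens_topology p q) (image P)"
    unfolding P_def using cd p by (intro lens_diag_homeomorphic) auto
  let ?M = "\<lambda>x. {v \<in> S3. \<exists>u\<in>nearest_sites x v. \<exists>u'\<in>nearest_sites x v. u \<noteq> u'}"
  have M: "P ` ?M x = ?M x'"
  proof (intro equalityI subsetI)
    fix v assume "v \<in> P ` ?M x"
    then obtain w u u' where w: "w \<in> S3" "v = P w"
      and u: "u \<in> nearest_sites x w" "u' \<in> nearest_sites x w" "u \<noteq> u'" by blast
    have "diag_map c d u \<in> nearest_sites x' v" "diag_map c d u' \<in> nearest_sites x' v"
      unfolding w(2) near[OF w(1)] using u(1,2) by (simp_all only: imageI)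
    moreover have "diag_map c d u \<noteq> diag_map c d u'" using u(3) inj by simp
    ultimately show "v \<in> ?M x'" using PS[OF w(1)] unfolding w(2) by blast
  next
    fix v assume "v \<in> ?M x'"
    then obtain s s' where vS: "v \<in> S3"
      and s: "s \<in> nearest_sites x' v" "s' \<in> nearest_sites x' v" "s \<noteq> s'" by blast
    have "nearest_sites x' v = diag_map c d ` nearest_sites x (Q v)"
      using near[OF QS[OF vS]] unfolding PQ[OF vS] .
    then obtain u u' where u: "u \<in> nearest_sites x (Q v)" "u' \<in> nearest_sites x (Q v)"
      and "s = diag_map c d u" "s' = diag_map c d u'" using s(1,2) by (metis imageE)
    then have "u \<noteq> u'" using s(3) by blast
    then have "Q v \<in> ?M x" using u QS[OF vS] by blast
    then have "P (Q v) \<in> P ` ?M x" by (rule imageI)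
    then show "v \<in> P ` ?M x" unfolding PQ[OF vS] .
  qed
  have imM: "image P ` lens_proj p q ` ?M x = lens_proj p q ` ?M x'"
    unfolding M[symmetric] image_image projP ..
  have subM: "lens_proj p q ` ?M x \<subseteq> topspace (lens_topology p q)"
    unfolding topspace_lens_topology lens_space_def by blast
  obtain y y' where y: "y \<in> x" "y' \<in> x" "y \<noteq> y'" using two by blast
  obtain z z' where z: "z \<in> x'" "z' \<in> x'" "z \<noteq> z'" using two' by blast
  \<comment> \<open>A homeomorphism commutes with closure, so matching the sets before closure is
    enough.\<close>
  have cut: "image P ` cut_locus p q x = cut_locus p q x'"
    unfolding cut_locus_eq[OF p(1) assms(3) xL(1) y] cut_locus_eq[OF p(1) assms(3) xL(2) z]
      homeomorphic_map_closure_of[OF hom subM, symmetric] imM ..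
  have sub: "cut_locus p q X \<subseteq> topspace (lens_topology p q)" for X
    unfolding cut_locus_def by (rule closure_of_subset_topspace)
  have "homeomorphic_map (subtopology (lens_topology p q) (cut_locus p q x))
      (subtopology (lens_topology p q) (cut_locus p q x')) (image P)"
    using cut sub by (intro homeomorphic_map_subtopologies[OF hom]) (simp add: inf.absorb2)
  then show "same_combinatorial_type
      (subtopology (lens_topology p q) (cut_locus p q x)) (cut_locus_cells p q x)
      (subtopology (lens_topology p q) (cut_locus p q x')) (cut_locus_cells p q x')"
    unfolding same_combinatorial_type_def using cells by blast
qed

end
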